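(* Let $n>1$ be an integer and let $m_1,m_2,\ldots,m_{n-1}$ be integers with $\gcd(m_s,n)\le s$ for all $s=1,\ldots,n-1$. Then for any integers $a_1,\ldots,a_{n-1}$, there is a function $f:\{1,\ldots,n-1\}\to\{1,\ldots,n-1\}$ such that the sums $$f(1)+a_1,\ \ldots,\ f(n-1)+a_{n-1}$$ are pairwise distinct modulo $n$, and none of the numbers $f(1)m_1,\ \ldots,\ f(n-1)m_{n-1}$ is divisible by $n$.
   Context: $\gcd(a,n)$ denotes the greatest common divisor of the integer $a$ and the positive integer $n$ (with $\gcd(0,n)=n$). *)

theory Defs
  imports "HOL-Number_Theory.Cong" "HOL-Library.FuncSet"
begin

end

(* Since f(s) m_s is divisible by n for exactly gcd(m_s, n) residues f(s), at least n - s values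
   are admissible for f(s).  Choosing f(n-1), f(n-2), ..., f(1) greedily in this order, only
   n - 1 - s residues are already taken when f(s) is chosen, so a choice always remains. *)
theory Submission
  imports Defs
begin

text \<open>An easy case of Hall's theorem: the indices before \<open>k\<close> occupy at most
  \<open>k\<close> values, so \<open>B k\<close> still contains a fresh one. The induction extends
  \<open>g\<close> by such a value.\<close>

lemma greedy_transversal:
  fixes B :: "nat \<Rightarrow> 'a set"
  assumes "\<And>k. k < N \<Longrightarrow> k < card (B k)"
  shows "\<exists>g. (\<forall>k<N. g k \<in> B k) \<and> inj_on g {..<N}"
  using assms
proof (induction N)
  case 0
  show ?case by simp
next
  case (Suc N)
  then obtain g where g: "\<forall>k<N. g k \<in> B k" "inj_on g {..<N}"
    by (meson less_SucI)
  have "card (g ` {..<N}) < card (B N)"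
    using Suc.prems[of N] card_image[OF g(2)] by simp
  then have "\<not> B N \<subseteq> g ` {..<N}"
    using card_mono[of "g ` {..<N}" "B N"] by fastforce
  then obtain y where y: "y \<in> B N" "y \<notin> g ` {..<N}"
    by blast
  have "inj_on (g(N := y)) {..<Suc N}"
    using g(2) y(2) by (auto simp: inj_on_def less_Suc_eq)
  moreover have "\<forall>k<Suc N. (g(N := y)) k \<in> B k"
    using g(1) y(1) by (auto simp: less_Suc_eq)
  ultimately show ?case by blast
qed

text \<open>With \<open>d\<close> the gcd, \<open>n = d * q\<close> and \<open>m = d * r\<close>,
  cancelling \<open>d\<close> turns the condition into \<open>q dvd x * r\<close>, hence
  \<open>q dvd x\<close> as \<open>q\<close> and \<open>r\<close> are coprime. Below
  \<open>n = d * q\<close> there are only \<open>d\<close> multiples of \<open>q\<close>.\<close>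

lemma card_annihilator_le_gcd:
  fixes n :: nat and m :: int
  assumes "n > 0"
  shows "int (card {x \<in> {..<n}. int n dvd int x * m}) \<le> gcd m (int n)"
proof -
  define d where "d = nat (gcd m (int n))"
  have d: "int d = gcd m (int n)" "d > 0"
    using assms by (auto simp: d_def)
  then have "d dvd n" "int d dvd m"
    by (auto simp flip: int_dvd_int_iff)
  then obtain q r where q: "n = d * q" and r: "m = int d * r"
    by (elim dvdE)
  have "int d * gcd r (int q) = int d"
    using d(1) gcd_mult_distrib_int[of "int d" r "int q"] by (simp add: q r)
  then have cop: "coprime (int q) r"
    using d(2) by (simp add: coprime_iff_gcd_eq_1 gcd.commute)
  have "{x \<in> {..<n}. int n dvd int x * m} \<subseteq> (\<lambda>k. q * k) ` {..<d}"
  proof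
    fix x assume x: "x \<in> {x \<in> {..<n}. int n dvd int x * m}"
    then have "int d * int q dvd int d * (int x * r)"
      by (simp add: q r ac_simps)
    then have "int q dvd int x * r"
      using d(2) by simp
    then have "q dvd x"
      using cop by (simp add: coprime_dvd_mult_left_iff)
    then show "x \<in> (\<lambda>k. q * k) ` {..<d}"
      using x by (auto simp: q mult.commute)
  qed
  then have "card {x \<in> {..<n}. int n dvd int x * m} \<le> card {..<d}"
    by (rule surj_card_le[rotated]) simp
  then show ?thesis
    using d(1) by simp
qed

theorem theorem1p3:
  fixes n :: nat and m a :: "nat \<Rightarrow> int"
  assumes "n > 1"
    and "\<And>s. s \<in> {1..n-1} \<Longrightarrow> gcd (m s) (int n) \<le> int s"
  shows "\<exists>f :: nat \<Rightarrow> nat. f \<in> {1..n-1} \<rightarrow> {1..n-1}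
    \<and> (\<forall>i\<in>{1..n-1}. \<forall>j\<in>{1..n-1}. i \<noteq> j \<longrightarrow>
          \<not> [int (f i) + a i = int (f j) + a j] (mod int n))
    \<and> (\<forall>s\<in>{1..n-1}. \<not> int n dvd int (f s) * m s)"
proof -
  define G where "G s = {x \<in> {..<n}. \<not> int n dvd int x * m s}" for s
  \<comment> \<open>The sums, not the values of \<open>f\<close>, must differ modulo
    \<open>n\<close>, so the greedy choice is made among the shifted residues
    \<open>h s x\<close>.\<close>
  define h where "h s x = (int x + a s) mod int n" for s x
  \<comment> \<open>The value 0 is excluded because \<open>n\<close> divides
    \<open>0 * m s\<close>.\<close>
  have G_range: "x \<in> {1..n-1}" if "x \<in> G s" for s x
    using that by (cases x) (auto simp: G_def)
  have card_G: "n - s \<le> card (G s)" if "s \<in> {1..n-1}" for s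
  proof -
    have "G s = {..<n} - {x \<in> {..<n}. int n dvd int x * m s}"
      by (auto simp: G_def)
    then have "card (G s) = n - card {x \<in> {..<n}. int n dvd int x * m s}"
      by (simp add: card_Diff_subset subset_iff)
    then show ?thesis
      using card_annihilator_le_gcd[of n "m s"] assms(1) assms(2)[OF that] by linarith
  qed
  have inj: "inj_on (h s) (G s)" for s
  proof (rule inj_onI)
    fix x y assume "x \<in> G s" "y \<in> G s" "h s x = h s y"
    then have "[int x + a s = int y + a s] (mod int n)" "x < n" "y < n"
      by (auto simp: h_def G_def cong_def)
    then show "x = y"
      by (simp add: cong_add_rcancel cong_int_iff cong_less_modulus_unique_nat)
  qed
  \<comment> \<open>Reversing the order by \<open>s = n - 1 - k\<close> makes the bound
    \<open>n - s\<close> equal to \<open>k + 1\<close>, just enough for the greedy lemma; the shift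
    by \<open>a s\<close> preserves cardinality.\<close>
  have "k < card (h (n - 1 - k) ` G (n - 1 - k))" if "k < n - 1" for k
  proof -
    have "n - 1 - k \<in> {1..n-1}"
      using that by auto
    from card_G[OF this] that show ?thesis
      by (simp add: card_image[OF inj])
  qed
  from greedy_transversal[of "n - 1" "\<lambda>k. h (n - 1 - k) ` G (n - 1 - k)", OF this]
  obtain g where g: "\<And>k. k < n - 1 \<Longrightarrow> g k \<in> h (n - 1 - k) ` G (n - 1 - k)"
    and inj_g: "inj_on g {..<n-1}"
    by blast
  \<comment> \<open>Undoing the reversal, each chosen residue is pulled back along
    \<open>h s\<close> to an admissible value for \<open>f s\<close>.\<close>
  have "\<exists>x. x \<in> G s \<and> g (n - 1 - s) = h s x" if "s \<in> {1..n-1}" for s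
  proof -
    have "n - 1 - s < n - 1" "n - 1 - (n - 1 - s) = s"
      using that by auto
    with g[of "n - 1 - s"] show ?thesis
      by auto
  qed
  then obtain f where f: "\<And>s. s \<in> {1..n-1} \<Longrightarrow> f s \<in> G s"
    and gf: "\<And>s. s \<in> {1..n-1} \<Longrightarrow> g (n - 1 - s) = h s (f s)"
    by metis
  have "\<not> [int (f i) + a i = int (f j) + a j] (mod int n)"
    if ij: "i \<in> {1..n-1}" "j \<in> {1..n-1}" "i \<noteq> j" for i j
  proof
    assume "[int (f i) + a i = int (f j) + a j] (mod int n)"
    then have "g (n - 1 - i) = g (n - 1 - j)"
      unfolding gf[OF ij(1)] gf[OF ij(2)] by (simp add: h_def cong_def)
    then have "n - 1 - i = n - 1 - j"
      using ij(1,2) by (intro inj_onD[OF inj_g]) auto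
    then show False
      using ij by auto
  qed
  moreover have "f \<in> {1..n-1} \<rightarrow> {1..n-1}"
    using f G_range by blast
  moreover have "\<not> int n dvd int (f s) * m s" if "s \<in> {1..n-1}" for s
    using f[OF that] by (simp add: G_def)
  ultimately show ?thesis
    by blast
qed

end
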